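(* A ring $R$ is weakly clean and $W\Delta U$ with $2\in U(R)$ if and only if $R/J(R)\cong\mathbb{Z}_3$.
   Context: Rings are associative with identity, not necessarily commutative. $J(R)$ is the Jacobson radical and $U(R)$ the group of units of $R$. $\Delta(R)=\{r\in R : r+u\in U(R)\text{ for all }u\in U(R)\}$; equivalently $\Delta(R)=J(T)$, where $T$ is the subring of $R$ generated by $U(R)$. $R$ is $W\Delta U$ if $U(R)=\pm 1+\Delta(R)$, i.e. every unit of $R$ has the form $1+d$ or $-1+d$ with $d\in\Delta(R)$. $R$ is weakly clean if every $r\in R$ can be written as $r=u+e$ or $r=u-e$ with $u\in U(R)$ and $e^2=e\in R$. *)

theory Defs
  imports "HOL-Algebra.Algebra" "HOL-Number_Theory.Residues"
begin

text \<open>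
  The library's \<^const>\<open>ideal\<close> and \<^const>\<open>maximalideal\<close> are two-sided. For a ring that need not be
  commutative, the Jacobson radical is the intersection of the maximal left ideals.
\<close>

definition left_ideal :: "'a set \<Rightarrow> ('a, 'b) ring_scheme \<Rightarrow> bool" where
  "left_ideal I R \<longleftrightarrow> additive_subgroup I R \<and>
     (\<forall>r\<in>carrier R. \<forall>x\<in>I. r \<otimes>\<^bsub>R\<^esub> x \<in> I)"

definition maximal_left_ideal :: "'a set \<Rightarrow> ('a, 'b) ring_scheme \<Rightarrow> bool" where
  "maximal_left_ideal M R \<longleftrightarrow> left_ideal M R \<and> M \<noteq> carrier R \<and>
     (\<forall>I. left_ideal I R \<and> M \<subseteq> I \<longrightarrow> I = M \<or> I = carrier R)"

definition jacobson_radical :: "('a, 'b) ring_scheme \<Rightarrow> 'a set" where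
  "jacobson_radical R = {x \<in> carrier R. \<forall>M. maximal_left_ideal M R \<longrightarrow> x \<in> M}"

definition Delta :: "('a, 'b) ring_scheme \<Rightarrow> 'a set" where
  "Delta R = {r \<in> carrier R. \<forall>u\<in>Units R. r \<oplus>\<^bsub>R\<^esub> u \<in> Units R}"

definition WDeltaU :: "('a, 'b) ring_scheme \<Rightarrow> bool" where
  "WDeltaU R \<longleftrightarrow>
     Units R = (\<one>\<^bsub>R\<^esub> <+\<^bsub>R\<^esub> Delta R) \<union> ((\<ominus>\<^bsub>R\<^esub> \<one>\<^bsub>R\<^esub>) <+\<^bsub>R\<^esub> Delta R)"

definition weakly_clean :: "('a, 'b) ring_scheme \<Rightarrow> bool" where
  "weakly_clean R \<longleftrightarrow> (\<forall>r\<in>carrier R. \<exists>u\<in>Units R. \<exists>e\<in>carrier R.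
     e \<otimes>\<^bsub>R\<^esub> e = e \<and> (r = u \<oplus>\<^bsub>R\<^esub> e \<or> r = u \<ominus>\<^bsub>R\<^esub> e))"

end

theory Submission
  imports Defs
begin

text \<open>
  Let \<open>2\<close> be a unit and let every unit be \<open>\<plusminus>1\<close> modulo \<open>\<Delta>\<close>. If \<open>e\<close> is idempotent, then \<open>1 - 2e\<close> is its
  own inverse, so \<open>2e\<close> or \<open>2(1 - e)\<close> lies in \<open>\<Delta>\<close>, hence so does \<open>e\<close> or \<open>1 - e\<close>; as \<open>\<Delta>\<close> contains no
  nonzero idempotent, \<open>e\<close> is \<open>0\<close> or \<open>1\<close>. Since also \<open>3 \<in> \<Delta>\<close>, weak cleanness puts every element in
  \<open>\<Delta>\<close> or \<open>\<plusminus>1 + \<Delta>\<close>. So every element or its successor is a unit, which makes \<open>\<Delta>\<close> a left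
  ideal and therefore equal to the Jacobson radical. Conversely, if every element is \<open>0\<close> or \<open>\<plusminus>1\<close>
  modulo the radical \<open>J\<close>, then the units are exactly \<open>\<plusminus>1 + J\<close>, whence \<open>\<Delta> = J\<close>.
\<close>

section \<open>Left ideals and the Jacobson radical\<close>

context ring
begin

section \<open>Closure properties of left ideals and the existence of maximal ones\<close>

lemma left_idealI:
  assumes "I \<subseteq> carrier R" "\<zero> \<in> I" "\<And>a b. a \<in> I \<Longrightarrow> b \<in> I \<Longrightarrow> a \<oplus> b \<in> I"
    and l: "\<And>r a. r \<in> carrier R \<Longrightarrow> a \<in> I \<Longrightarrow> r \<otimes> a \<in> I"
  shows "left_ideal I R"
proof -
  have "\<ominus> a \<in> I" if "a \<in> I" for a
    using l[of "\<ominus> \<one>" a] that assms(1) l_minus[of \<one> a] by auto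
  then have "subgroup I (add_monoid R)"
    using assms by (intro add.subgroupI) auto
  then show ?thesis
    using l by (auto simp: left_ideal_def intro: additive_subgroupI)
qed

lemma left_idealD:
  assumes "left_ideal I R"
  shows "I \<subseteq> carrier R" "\<zero> \<in> I" "\<And>a b. a \<in> I \<Longrightarrow> b \<in> I \<Longrightarrow> a \<oplus> b \<in> I"
    "\<And>r a. r \<in> carrier R \<Longrightarrow> a \<in> I \<Longrightarrow> r \<otimes> a \<in> I"
    "\<And>a. a \<in> I \<Longrightarrow> \<ominus> a \<in> I"
  using assms additive_subgroup.a_subset[of I R] additive_subgroup.zero_closed[of I R]
    additive_subgroup.a_closed[of I R]
    additive_subgroup.a_inv_closed[of I R]
  by (auto simp: left_ideal_def is_abelian_group)

lemma left_ideal_eq_carrier: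
  assumes "left_ideal I R" "\<one> \<in> I"
  shows "I = carrier R"
  using left_idealD(1,4)[OF assms(1)] assms(2) r_one by (metis subsetI subset_antisym)

lemma left_ideal_Union_chain:
  assumes "C \<noteq> {}" "subset.chain {I. left_ideal I R} C"
  shows "left_ideal (\<Union>C) R"
proof (rule left_idealI)
  have C: "left_ideal I R" if "I \<in> C" for I
    using that assms(2) unfolding subset.chain_def by blast
  show "\<Union>C \<subseteq> carrier R" "\<zero> \<in> \<Union>C"
    using C assms(1) left_idealD by blast+
  show "r \<otimes> a \<in> \<Union>C" if "r \<in> carrier R" "a \<in> \<Union>C" for r a
    using that C left_idealD(4) by blast
  show "a \<oplus> b \<in> \<Union>C" if ab: "a \<in> \<Union>C" "b \<in> \<Union>C" for a b
  proof -
    obtain A B where "A \<in> C" "B \<in> C" "a \<in> A" "b \<in> B"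
      using ab by blast
    moreover have "A \<subseteq> B \<or> B \<subseteq> A"
      using assms(2) calculation unfolding subset_chain_def by blast
    ultimately show ?thesis
      using C left_idealD(3) by (metis UnionI subsetD)
  qed
qed

text \<open>Zorn's lemma is applied to the left ideals that contain \<open>I\<close> and avoid
  \<open>\<one>\<close>. A left ideal is proper exactly when it avoids \<open>\<one>\<close>, and
  that condition survives unions of chains.\<close>

lemma left_ideal_subset_maximal:
  assumes "left_ideal I R" "\<one> \<notin> I"
  obtains M where "maximal_left_ideal M R" "I \<subseteq> M"
proof -
  let ?A = "{K. left_ideal K R \<and> I \<subseteq> K \<and> \<one> \<notin> K}"
  have "\<exists>M\<in>?A. \<forall>K\<in>?A. M \<subseteq> K \<longrightarrow> K = M"
  proof (rule subset_Zorn_nonempty)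
    show "?A \<noteq> {}"
      using assms by blast
    show "\<Union>C \<in> ?A" if C: "C \<noteq> {}" "subset.chain ?A C" for C
    proof -
      have CA: "C \<subseteq> ?A"
        using C(2) by (simp add: subset_chain_def)
      then have "C \<subseteq> {I. left_ideal I R}"
        by blast
      then have "subset.chain {I. left_ideal I R} C"
        using C(2) by (simp add: subset_chain_def)
      with C(1) have "left_ideal (\<Union>C) R"
        by (rule left_ideal_Union_chain)
      moreover obtain K where "K \<in> C"
        using C(1) by blast
      ultimately show ?thesis
        using CA by blast
    qed
  qed
  then obtain M where "M \<in> ?A" and A: "\<forall>K\<in>?A. M \<subseteq> K \<longrightarrow> K = M"
    by (rule bexE)
  then have M: "left_ideal M R" "I \<subseteq> M" "\<one> \<notin> M"
    by simp_all
  have max: "K = M" if "left_ideal K R" "\<one> \<notin> K" "M \<subseteq> K" for K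
    using A that M(2) by simp
  have "maximal_left_ideal M R"
    unfolding maximal_left_ideal_def
  proof (intro conjI allI impI)
    show "left_ideal M R" "M \<noteq> carrier R"
      using M by auto
    show "K = M \<or> K = carrier R" if "left_ideal K R \<and> M \<subseteq> K" for K
      using that max[of K] left_ideal_eq_carrier[of K] by metis
  qed
  then show thesis
    using M(2) by (rule that)
qed

section \<open>Principal left ideals and the description of the radical by left inverses\<close>

lemma left_ideal_principal:
  assumes "x \<in> carrier R"
  shows "left_ideal ((\<lambda>r. r \<otimes> x) ` carrier R) R"
proof (rule left_idealI)
  show "\<zero> \<in> (\<lambda>r. r \<otimes> x) ` carrier R"
    using assms by (intro image_eqI[of _ _ \<zero>]) auto
qed (use assms in \<open>auto simp: l_distr[symmetric] m_assoc[symmetric]\<close>)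

lemma left_ideal_sum_principal:
  assumes "left_ideal I R" "x \<in> carrier R"
  shows "left_ideal {m \<oplus> r \<otimes> x | m r. m \<in> I \<and> r \<in> carrier R} R" (is "left_ideal ?S R")
proof (rule left_idealI)
  note I = left_idealD[OF assms(1)]
  have I': "m \<in> carrier R" if "m \<in> I" for m
    using that I(1) by blast
  show "?S \<subseteq> carrier R"
    using I' assms(2) by auto
  have "\<zero> = \<zero> \<oplus> \<zero> \<otimes> x"
    using assms(2) by simp
  then show "\<zero> \<in> ?S"
    using I(2) by blast
  show "s \<otimes> a \<in> ?S" if s: "s \<in> carrier R" and a: "a \<in> ?S" for s a
  proof -
    obtain m r where mr: "a = m \<oplus> r \<otimes> x" "m \<in> I" "r \<in> carrier R"
      using a by blast
    then have "s \<otimes> a = s \<otimes> m \<oplus> (s \<otimes> r) \<otimes> x"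
      using s assms(2) I' by (simp add: r_distr m_assoc)
    then show ?thesis
      using mr s I(4) by blast
  qed
  show "a \<oplus> b \<in> ?S" if a: "a \<in> ?S" and b: "b \<in> ?S" for a b
  proof -
    obtain m r n s where mr: "a = m \<oplus> r \<otimes> x" "m \<in> I" "r \<in> carrier R"
      "b = n \<oplus> s \<otimes> x" "n \<in> I" "s \<in> carrier R"
      using a b by blast
    then have "a \<oplus> b = (m \<oplus> n) \<oplus> (r \<oplus> s) \<otimes> x"
      using assms(2) I' by (simp add: l_distr a_ac)
    then show ?thesis
      using mr I(3) by blast
  qed
qed

text \<open>If \<open>1 - rx\<close> had no left inverse, the left ideal it generates would lie in a
  maximal one, which also contains \<open>rx\<close> and hence \<open>1\<close>. Conversely, if
  \<open>x\<close> lies outside a maximal left ideal \<open>M\<close>, then \<open>M + Rx\<close> is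
  the whole ring, so \<open>1 = m + rx\<close> with \<open>m\<close> in \<open>M\<close>; but then
  \<open>m = 1 - rx\<close> has a left inverse, which puts \<open>1\<close> in
  \<open>M\<close>.\<close>

lemma jacobson_radical_iff:
  "x \<in> jacobson_radical R \<longleftrightarrow>
     x \<in> carrier R \<and> (\<forall>r\<in>carrier R. \<exists>c\<in>carrier R. c \<otimes> (\<one> \<ominus> r \<otimes> x) = \<one>)"
proof (intro iffI conjI ballI)
  assume x: "x \<in> jacobson_radical R"
  then show xc: "x \<in> carrier R"
    by (simp add: jacobson_radical_def)
  fix r assume r: "r \<in> carrier R"
  let ?y = "\<one> \<ominus> r \<otimes> x"
  let ?P = "(\<lambda>c. c \<otimes> ?y) ` carrier R"
  have y: "?y \<in> carrier R"
    using xc r by simp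
  show "\<exists>c\<in>carrier R. c \<otimes> ?y = \<one>"
  proof (rule ccontr)
    assume "\<not> ?thesis"
    then have "\<one> \<notin> ?P"
      by auto
    then obtain M where M: "maximal_left_ideal M R" "?P \<subseteq> M"
      using left_ideal_subset_maximal left_ideal_principal[OF y] by metis
    have lM: "left_ideal M R" and "M \<noteq> carrier R"
      using M(1) by (auto simp: maximal_left_ideal_def)
    have "?y \<in> ?P"
      using y by (intro image_eqI[of _ _ \<one>]) auto
    then have "?y \<in> M" "r \<otimes> x \<in> M"
      using x M r left_idealD(4)[OF lM] by (auto simp: jacobson_radical_def)
    then have "?y \<oplus> r \<otimes> x \<in> M"
      using left_idealD(3)[OF lM] by blast
    moreover have "?y \<oplus> r \<otimes> x = \<one>"
      using xc r by (simp add: minus_eq a_assoc l_neg)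
    ultimately show False
      using left_ideal_eq_carrier[OF lM] \<open>M \<noteq> carrier R\<close> by simp
  qed
next
  assume asm: "x \<in> carrier R \<and> (\<forall>r\<in>carrier R. \<exists>c\<in>carrier R. c \<otimes> (\<one> \<ominus> r \<otimes> x) = \<one>)"
  then have x: "x \<in> carrier R"
    by blast
  have "x \<in> M" if M: "maximal_left_ideal M R" for M
  proof (rule ccontr)
    assume "x \<notin> M"
    have lM: "left_ideal M R" and "M \<noteq> carrier R"
      using M by (auto simp: maximal_left_ideal_def)
    note MD = left_idealD[OF lM]
    let ?S = "{m \<oplus> r \<otimes> x | m r. m \<in> M \<and> r \<in> carrier R}"
    have "m \<in> ?S" if "m \<in> M" for m
    proof -
      have "m = m \<oplus> \<zero> \<otimes> x"
        using that MD(1) x by auto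
      then show ?thesis
        using that by blast
    qed
    moreover have "x \<in> ?S"
    proof -
      have "x = \<zero> \<oplus> \<one> \<otimes> x"
        using x by simp
      then show ?thesis
        using MD(2) by blast
    qed
    ultimately have "?S = carrier R"
      using M left_ideal_sum_principal[OF lM x] \<open>x \<notin> M\<close>
      unfolding maximal_left_ideal_def by blast
    then have "\<one> \<in> ?S"
      by simp
    then obtain m r where m: "m \<in> M" and r: "r \<in> carrier R" and one: "\<one> = m \<oplus> r \<otimes> x"
      by blast
    have "m = \<one> \<ominus> r \<otimes> x"
      using m MD(1) r x unfolding one by (auto simp: minus_eq a_assoc r_neg)
    then obtain c where "c \<in> carrier R" "c \<otimes> m = \<one>"
      using asm r by blast
    then show False
      using MD(4) m left_ideal_eq_carrier[OF lM] \<open>M \<noteq> carrier R\<close> by metis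
  qed
  with x show "x \<in> jacobson_radical R"
    by (simp add: jacobson_radical_def)
qed

lemma left_ideal_jacobson_radical: "left_ideal (jacobson_radical R) R"
  by (rule left_idealI) (auto simp: jacobson_radical_def maximal_left_ideal_def left_idealD)

text \<open>The witness comes from the formal expansion \<open>1 + ab + abab + \<dots> = 1 + a(1 + ba + \<dots>)b\<close>.\<close>

lemma left_inverse_one_minus_swap:
  assumes "a \<in> carrier R" "b \<in> carrier R" "c \<in> carrier R" "c \<otimes> (\<one> \<ominus> b \<otimes> a) = \<one>"
  shows "(\<one> \<oplus> a \<otimes> c \<otimes> b) \<otimes> (\<one> \<ominus> a \<otimes> b) = \<one>"
proof -
  have "(\<one> \<oplus> a \<otimes> c \<otimes> b) \<otimes> (\<one> \<ominus> a \<otimes> b)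
      = (\<one> \<ominus> a \<otimes> b) \<oplus> a \<otimes> (c \<otimes> (\<one> \<ominus> b \<otimes> a)) \<otimes> b"
    using assms(1-3) by (simp add: ring_simprules r_distr)
  also have "\<dots> = \<one>"
    unfolding assms(4) using assms(1-3) by (simp add: ring_simprules r_distr)
  finally show ?thesis .
qed

text \<open>Closure under right multiplication is the real content, since the radical is defined by
  left ideals. For \<open>x\<close> in the radical, \<open>1 - s(rx)\<close> has a left inverse, and
  swapping the factors \<open>s\<close> and \<open>rx\<close> gives one for
  \<open>1 - (rx)s\<close>.\<close>

lemma ideal_jacobson_radical: "ideal (jacobson_radical R) R"
proof (rule idealI)
  note J = left_idealD[OF left_ideal_jacobson_radical]
  show "subgroup (jacobson_radical R) (add_monoid R)"
    using left_ideal_jacobson_radical by (simp add: left_ideal_def additive_subgroup_def)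
  show "s \<otimes> x \<in> jacobson_radical R" if "x \<in> jacobson_radical R" "s \<in> carrier R" for x s
    using that J by blast
  show "x \<otimes> s \<in> jacobson_radical R" if x: "x \<in> jacobson_radical R" and s: "s \<in> carrier R" for x s
    unfolding jacobson_radical_iff
  proof (intro conjI ballI)
    have xc: "x \<in> carrier R"
      using x J by blast
    then show "x \<otimes> s \<in> carrier R"
      using s by simp
    fix r assume r: "r \<in> carrier R"
    obtain c where c: "c \<in> carrier R" "c \<otimes> (\<one> \<ominus> (s \<otimes> r) \<otimes> x) = \<one>"
      using x s r unfolding jacobson_radical_iff by blast
    then have "c \<otimes> (\<one> \<ominus> s \<otimes> (r \<otimes> x)) = \<one>"
      using xc s r by (simp add: m_assoc)
    then have "(\<one> \<oplus> (r \<otimes> x) \<otimes> c \<otimes> s) \<otimes> (\<one> \<ominus> (r \<otimes> x) \<otimes> s) = \<one>"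
      using xc s r c(1) by (intro left_inverse_one_minus_swap) auto
    then show "\<exists>c\<in>carrier R. c \<otimes> (\<one> \<ominus> r \<otimes> (x \<otimes> s)) = \<one>"
      using xc s r c(1) by (intro bexI[of _ "\<one> \<oplus> (r \<otimes> x) \<otimes> c \<otimes> s"]) (auto simp: m_assoc)
  qed
qed (rule ring_axioms)

text \<open>A left inverse \<open>c\<close> of \<open>1 + x\<close> equals \<open>1 - cx\<close>, so
  it again has the form \<open>1 + y\<close> with \<open>y\<close> in \<open>I\<close> and has a
  left inverse itself. An element with inverses on both sides is a unit, and the left inverse of
  \<open>c\<close> must be \<open>1 + x\<close>.\<close>

lemma one_plus_left_ideal_Units:
  assumes "left_ideal I R"
    and inv: "\<And>x. x \<in> I \<Longrightarrow> \<exists>c\<in>carrier R. c \<otimes> (\<one> \<oplus> x) = \<one>"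
    and x: "x \<in> I"
  shows "\<one> \<oplus> x \<in> Units R"
proof -
  note I = left_idealD[OF assms(1)]
  have xc: "x \<in> carrier R"
    using x I by blast
  obtain c where c: "c \<in> carrier R" "c \<otimes> (\<one> \<oplus> x) = \<one>"
    using inv x by blast
  have "c = c \<otimes> (\<one> \<oplus> x) \<oplus> \<ominus> (c \<otimes> x)"
    using c(1) xc by (simp add: r_distr a_assoc r_neg)
  then have "c = \<one> \<oplus> \<ominus> (c \<otimes> x)"
    unfolding c(2) .
  moreover have "\<ominus> (c \<otimes> x) \<in> I"
    using I c(1) x by blast
  ultimately obtain d where d: "d \<in> carrier R" "d \<otimes> c = \<one>"
    using inv by metis
  have "d = \<one> \<oplus> x"
    using inv_unique[OF d(2) c(2)] c(1) d(1) xc by simp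
  then show ?thesis
    using c d xc by (auto simp: Units_def)
qed

lemma one_plus_jacobson_radical_Units:
  assumes "x \<in> jacobson_radical R"
  shows "\<one> \<oplus> x \<in> Units R"
proof (rule one_plus_left_ideal_Units[OF left_ideal_jacobson_radical _ assms])
  fix y assume y: "y \<in> jacobson_radical R"
  then have yc: "y \<in> carrier R"
    by (simp add: jacobson_radical_iff)
  \<comment> \<open>The criterion for the radical is used with the multiplier
    \<open>r = -1\<close>.\<close>
  obtain c where "c \<in> carrier R" "c \<otimes> (\<one> \<ominus> (\<ominus> \<one>) \<otimes> y) = \<one>"
    using y unfolding jacobson_radical_iff by blast
  moreover have "\<one> \<ominus> (\<ominus> \<one>) \<otimes> y = \<one> \<oplus> y"
    using yc by algebra
  ultimately show "\<exists>c\<in>carrier R. c \<otimes> (\<one> \<oplus> y) = \<one>"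
    by auto
qed

text \<open>With \<open>x\<close> in \<open>I\<close>, also \<open>-rx\<close> is in
  \<open>I\<close>, so every \<open>1 - rx\<close> is a unit and in particular left invertible. This
  is how \<open>Delta R\<close> is later placed inside the radical.\<close>

lemma left_ideal_subset_jacobson_radical:
  assumes "left_ideal I R" and "\<And>x. x \<in> I \<Longrightarrow> \<one> \<oplus> x \<in> Units R"
  shows "I \<subseteq> jacobson_radical R"
proof
  fix x assume x: "x \<in> I"
  note I = left_idealD[OF assms(1)]
  show "x \<in> jacobson_radical R"
    unfolding jacobson_radical_iff
  proof (intro conjI ballI)
    show "x \<in> carrier R"
      using x I by blast
    fix r assume "r \<in> carrier R"
    then have "\<ominus> (r \<otimes> x) \<in> I"
      using I x by blast
    then show "\<exists>c\<in>carrier R. c \<otimes> (\<one> \<ominus> r \<otimes> x) = \<one>"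
      using assms(2) Units_l_inv_ex by (simp add: minus_eq)
  qed
qed

lemma one_notin_jacobson_radical:
  assumes "\<one> \<noteq> \<zero>"
  shows "\<one> \<notin> jacobson_radical R"
proof
  assume "\<one> \<in> jacobson_radical R"
  then have "\<one> \<oplus> \<ominus> \<one> \<in> Units R"
    by (intro one_plus_jacobson_radical_Units left_idealD[OF left_ideal_jacobson_radical])
  then show False
    using assms by (auto simp: r_neg Units_def)
qed

section \<open>Units and the inclusion of the radical in \<open>Delta\<close>\<close>

lemma uminus_Units:
  assumes "u \<in> Units R"
  shows "\<ominus> u \<in> Units R"
proof -
  have "(\<ominus> (inv u)) \<otimes> (\<ominus> u) = \<one>" "(\<ominus> u) \<otimes> (\<ominus> (inv u)) = \<one>"
    using assms by (auto simp: l_minus r_minus Units_closed)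
  then show ?thesis
    using assms Units_inv_closed[OF assms] Units_closed[OF assms]
    unfolding Units_def[of R] by (blast intro: a_inv_closed)
qed

text \<open>For a unit \<open>u\<close>, factor \<open>u + x = u(1 + inv u x)\<close>; the second
  factor is a unit because \<open>inv u x\<close> is still in the radical.\<close>

lemma jacobson_radical_subset_Delta: "jacobson_radical R \<subseteq> Delta R"
proof
  fix x assume x: "x \<in> jacobson_radical R"
  note J = left_idealD[OF left_ideal_jacobson_radical]
  have xc: "x \<in> carrier R"
    using x J by blast
  have "x \<oplus> u \<in> Units R" if u: "u \<in> Units R" for u
  proof -
    have uc: "u \<in> carrier R" "inv u \<in> carrier R"
      using u by auto
    have "\<one> \<oplus> inv u \<otimes> x \<in> Units R"
      using J x uc by (intro one_plus_jacobson_radical_Units) blast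
    then have "u \<otimes> (\<one> \<oplus> inv u \<otimes> x) \<in> Units R"
      using u by blast
    moreover have "u \<otimes> (\<one> \<oplus> inv u \<otimes> x) = u \<oplus> (u \<otimes> inv u) \<otimes> x"
      using uc xc by (simp add: r_distr m_assoc)
    ultimately show ?thesis
      using u uc xc by (simp add: a_comm)
  qed
  with xc show "x \<in> Delta R"
    by (simp add: Delta_def)
qed

end

section \<open>Quotients isomorphic to the field with three elements\<close>

context ideal
begin

text \<open>Division with remainder by 3 reduces \<open>k\<close> to 0, 1 or 2, and neither
  \<open>1\<close> nor \<open>2\<close> lies in \<open>I\<close>, since \<open>1 = 3 - 2\<close>.
  The lemma makes the residue modulo 3 attached to an element well defined.\<close>

lemma int_multiple_one_mem_iff:
  assumes "\<one> \<notin> I" "\<one> \<oplus> \<one> \<oplus> \<one> \<in> I"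
  shows "[(k::int)] \<cdot> \<one> \<in> I \<longleftrightarrow> k mod 3 = 0"
proof -
  have three: "[(3::int)] \<cdot> \<one> = \<one> \<oplus> \<one> \<oplus> \<one>"
    and two: "[(2::int)] \<cdot> \<one> = \<one> \<oplus> \<one>"
    using add.int_pow_mult[of \<one> 1 1] add.int_pow_mult[of \<one> 2 1] by auto
  have mult: "[(3 * q)] \<cdot> \<one> \<in> I" for q :: int
  proof -
    have "[(3 * q)] \<cdot> \<one> = [q] \<cdot> ([(3::int)] \<cdot> \<one>)"
      using add.int_pow_pow[of \<one> q 3] by (simp add: mult.commute)
    also have "\<dots> = ([q] \<cdot> \<one>) \<otimes> ([(3::int)] \<cdot> \<one>)"
      by (simp add: add_pow_ldistr_int)
    finally show ?thesis
      using assms(2) I_l_closed by (simp add: three)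
  qed
  have split: "[k] \<cdot> \<one> = [(3 * (k div 3))] \<cdot> \<one> \<oplus> [(k mod 3)] \<cdot> \<one>"
    by (subst add.int_pow_mult[symmetric]) auto
  have "[(k mod 3)] \<cdot> \<one> \<in> I" if "[k] \<cdot> \<one> \<in> I"
  proof -
    have "\<ominus> ([(3 * (k div 3))] \<cdot> \<one>) \<oplus> [k] \<cdot> \<one> \<in> I"
      using mult that by blast
    then show ?thesis
      unfolding split by (simp add: r_neg1)
  qed
  moreover have "k mod 3 = 0 \<or> k mod 3 = 1 \<or> k mod 3 = 2"
    by presburger
  moreover have "\<one> \<oplus> \<one> \<notin> I"
  proof
    assume "\<one> \<oplus> \<one> \<in> I"
    then have "\<ominus> (\<one> \<oplus> \<one>) \<oplus> (\<one> \<oplus> \<one> \<oplus> \<one>) \<in> I"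
      using assms(2) by blast
    then show False
      using assms(1) by (simp add: r_neg1)
  qed
  moreover have "[k] \<cdot> \<one> \<in> I" if "k mod 3 = 0"
  proof -
    have "3 * (k div 3) = k"
      using that by presburger
    then show ?thesis
      using mult[of "k div 3"] by simp
  qed
  ultimately show ?thesis
    using assms(1) two by auto
qed

text \<open>This turns the isomorphism into conditions on elements. From left to right they are read
  off from the residues; from right to left the first isomorphism theorem is applied to the map
  sending \<open>r\<close> to the residue of any integer congruent to \<open>r\<close> modulo
  \<open>I\<close>.\<close>

lemma Quot_iso_residue_ring_3_iff:
  "R Quot I \<simeq> residue_ring 3 \<longleftrightarrow>
     \<one> \<notin> I \<and> \<one> \<oplus> \<one> \<oplus> \<one> \<in> I \<and> (\<forall>r\<in>carrier R. r \<in> I \<or> r \<ominus> \<one> \<in> I \<or> r \<oplus> \<one> \<in> I)"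
    (is "?L \<longleftrightarrow> ?R")
proof -
  interpret Z3: residues 3 "residue_ring 3"
    by (simp_all add: residues_def)
  note Z3_simps = Z3.res_zero_eq Z3.res_one_eq Z3.res_add_eq Z3.res_mult_eq Z3.res_carrier_eq
  show ?thesis
  proof
    assume ?L
    then obtain f where f: "f \<in> ring_iso (R Quot I) (residue_ring 3)"
      unfolding is_ring_iso_def by blast
    \<comment> \<open>Composing with the projection moves the question to \<open>R\<close>; as
      \<open>f\<close> is injective, the kernel of \<open>g\<close> is \<open>I\<close>.\<close>
    define g where "g r = f (I +> r)" for r
    have "g \<in> ring_hom R (residue_ring 3)"
      using ring_hom_trans[OF rcos_ring_hom, of f] f
      unfolding ring_iso_def g_def[abs_def] o_def by blast
    then interpret g: ring_hom_ring R "residue_ring 3" g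
      using ring_axioms Z3.ring_axioms by (intro ring_hom_ringI2)
    have mem: "r \<in> I \<longleftrightarrow> g r = 0" if r: "r \<in> carrier R" for r
    proof -
      have cosets: "I +> s \<in> carrier (R Quot I)" if "s \<in> carrier R" for s
        using that rcos_ring_hom by (auto simp: ring_hom_def)
      have "r \<in> I \<longleftrightarrow> I +> r = I +> \<zero>"
        using quotient_eq_iff_same_a_r_cos[OF is_ideal, of r \<zero>] r by (simp add: minus_eq)
      also have "\<dots> \<longleftrightarrow> g r = g \<zero>"
        using f r cosets unfolding ring_iso_def bij_betw_def g_def
        by (auto dest: inj_onD)
      finally show ?thesis
        by (simp add: Z3_simps)
    qed
    have "r \<in> I \<or> r \<ominus> \<one> \<in> I \<or> r \<oplus> \<one> \<in> I" if r: "r \<in> carrier R" for r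
    proof -
      \<comment> \<open>The three residues 0, 1 and 2 = -1 match the three alternatives in
        order.\<close>
      have "g r \<in> {0..2}"
        using g.hom_closed[OF r] by (simp add: Z3_simps)
      then have "g r = 0 \<or> g r = 1 \<or> g r = 2"
        by auto
      then show ?thesis
        using r by (auto simp: mem minus_eq Z3.res_neg_eq Z3_simps)
    qed
    moreover have "\<one> \<notin> I" "\<one> \<oplus> \<one> \<oplus> \<one> \<in> I"
      by (simp_all add: mem Z3_simps)
    ultimately show ?R
      by blast
  next
    assume ?R
    then have one: "\<one> \<notin> I" and three: "\<one> \<oplus> \<one> \<oplus> \<one> \<in> I"
      and cases: "\<And>r. r \<in> carrier R \<Longrightarrow> r \<in> I \<or> r \<ominus> \<one> \<in> I \<or> r \<oplus> \<one> \<in> I"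
      by auto
    let ?z = "\<lambda>k::int. [k] \<cdot> \<one>"
    have z_add: "?z (k + l) = ?z k \<oplus> ?z l" for k l
      by (simp add: add.int_pow_mult)
    have z_neg: "?z (- k) = \<ominus> ?z k" for k
      by (simp add: add.int_pow_neg)
    have z_mult: "?z (k * l) = ?z k \<otimes> ?z l" for k l
      using add.int_pow_pow[of \<one> k l] add_pow_ldistr_int[of \<one> "?z l" k]
      by (simp add: mult.commute)
    have z_0: "?z 0 = \<zero>"
      by (simp add: add_pow_def)
    have ex: "\<exists>k. r \<ominus> ?z k \<in> I" if "r \<in> carrier R" for r
    proof -
      have "r \<ominus> ?z 0 = r" "r \<ominus> ?z 1 = r \<ominus> \<one>" "r \<ominus> ?z (- 1) = r \<oplus> \<one>"
        using that z_neg[of 1] by (auto simp: minus_eq z_0)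
      then show ?thesis
        using cases[OF that] by metis
    qed
    \<comment> \<open>Many integers represent \<open>r\<close> modulo \<open>I\<close>, but two of
      them differ by a multiple of 3, so reduction modulo 3 removes the dependence on the choice;
      this is \<open>h_eq\<close>.\<close>
    define h where "h r = (SOME k. r \<ominus> ?z k \<in> I) mod 3" for r
    have h_eq: "h r = k mod 3" if r: "r \<in> carrier R" and k: "r \<ominus> ?z k \<in> I" for r k
    proof -
      define l where "l = (SOME k. r \<ominus> ?z k \<in> I)"
      have "r \<ominus> ?z l \<in> I"
        unfolding l_def using k by (rule someI)
      then have "(r \<ominus> ?z k) \<oplus> \<ominus> (r \<ominus> ?z l) \<in> I"
        using k by blast
      moreover have "(r \<ominus> ?z k) \<oplus> \<ominus> (r \<ominus> ?z l) = ?z l \<oplus> \<ominus> ?z k"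
        using r add.int_pow_closed[of \<one> k] add.int_pow_closed[of \<one> l] by algebra
      ultimately have "?z (l + - k) \<in> I"
        unfolding z_add z_neg by simp
      then have "(l - k) mod 3 = 0"
        using int_multiple_one_mem_iff[OF one three] by simp
      then show ?thesis
        unfolding h_def l_def[symmetric] by presburger
    qed
    have h_z: "h (?z k) = k mod 3" for k
      by (rule h_eq) (auto simp: minus_eq r_neg)
    have "h \<in> ring_hom R (residue_ring 3)"
    proof (rule ring_hom_memI)
      show "h \<one> = \<one>\<^bsub>residue_ring 3\<^esub>"
        using h_z[of 1] by (simp add: Z3_simps)
      fix r assume r: "r \<in> carrier R"
      show "h r \<in> carrier (residue_ring 3)"
        by (simp add: h_def)
      obtain k where k: "r \<ominus> ?z k \<in> I"
        using ex[OF r] by blast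
      fix s assume s: "s \<in> carrier R"
      obtain l where l: "s \<ominus> ?z l \<in> I"
        using ex[OF s] by blast
      have zc: "?z k \<in> carrier R" "?z l \<in> carrier R"
        by auto
      have "(r \<oplus> s) \<ominus> ?z (k + l) = (r \<ominus> ?z k) \<oplus> (s \<ominus> ?z l)"
        unfolding z_add using r s zc by algebra
      then have "(r \<oplus> s) \<ominus> ?z (k + l) \<in> I"
        using additive_subgroup.a_closed[OF is_additive_subgroup k l] by simp
      then have "h (r \<oplus> s) = (k + l) mod 3"
        using r s by (intro h_eq) simp_all
      then show "h (r \<oplus> s) = h r \<oplus>\<^bsub>residue_ring 3\<^esub> h s"
        by (simp add: h_eq[OF r k] h_eq[OF s l] Z3.add_cong)
      \<comment> \<open>The mixed term is inserted and removed; the two summands use absorption of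
        \<open>I\<close> on the right and on the left respectively.\<close>
      have "r \<otimes> s \<ominus> ?z (k * l) = (r \<ominus> ?z k) \<otimes> s \<oplus> ?z k \<otimes> (s \<ominus> ?z l)"
        unfolding z_mult using r s zc by algebra
      then have "r \<otimes> s \<ominus> ?z (k * l) \<in> I"
        using additive_subgroup.a_closed[OF is_additive_subgroup I_r_closed[OF k s]
            I_l_closed[OF l zc(1)]] by simp
      then have "h (r \<otimes> s) = (k * l) mod 3"
        using r s by (intro h_eq) simp_all
      then show "h (r \<otimes> s) = h r \<otimes>\<^bsub>residue_ring 3\<^esub> h s"
        by (simp add: h_eq[OF r k] h_eq[OF s l] Z3.mult_cong)
    qed
    then interpret h: ring_hom_ring R "residue_ring 3" h
      using ring_axioms Z3.ring_axioms by (intro ring_hom_ringI2)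
    have "h ` carrier R = carrier (residue_ring 3)"
    proof
      show "h ` carrier R \<subseteq> carrier (residue_ring 3)"
        using h.hom_closed by (rule image_subsetI)
      show "carrier (residue_ring 3) \<subseteq> h ` carrier R"
      proof
        fix k assume "k \<in> carrier (residue_ring 3)"
        then have "k = h (?z k)"
          unfolding h_z Z3_simps by simp
        then show "k \<in> h ` carrier R"
          by (rule image_eqI) simp
      qed
    qed
    moreover have "a_kernel R (residue_ring 3) h = I"
    proof -
      have "h r = 0 \<longleftrightarrow> r \<in> I" if r: "r \<in> carrier R" for r
      proof
        assume "r \<in> I"
        then show "h r = 0"
          using h_eq[OF r, of 0] r by (simp add: minus_eq z_0)
      next
        assume h0: "h r = 0"
        obtain k where k: "r \<ominus> ?z k \<in> I"
          using ex[OF r] by blast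
        have "k mod 3 = 0"
          using h0 h_eq[OF r k] by simp
        then have "?z k \<in> I"
          unfolding int_multiple_one_mem_iff[OF one three] .
        then have "(r \<ominus> ?z k) \<oplus> ?z k \<in> I"
          by (rule additive_subgroup.a_closed[OF is_additive_subgroup k])
        then show "r \<in> I"
          using r by (simp add: minus_eq a_assoc l_neg)
      qed
      then show ?thesis
        unfolding a_kernel_def' Z3_simps using a_subset by blast
    qed
    ultimately show ?L
      using h.FactRing_iso by simp
  qed
qed

end

section \<open>Rings with \<open>U(R) = \<plusminus>1 + \<Delta>(R)\<close>\<close>

context ring
begin

section \<open>Closure properties of \<open>Delta\<close> and its idempotents\<close>

lemma Delta_add_closed:
  assumes "a \<in> Delta R" "b \<in> Delta R"
  shows "a \<oplus> b \<in> Delta R"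
  using assms Units_closed by (auto simp: Delta_def a_assoc)

text \<open>For a unit \<open>v\<close>, factor \<open>ua + v = u(a + inv u v)\<close>, where
  \<open>inv u v\<close> is again a unit.\<close>

lemma Delta_Units_mult_closed:
  assumes u: "u \<in> Units R" and a: "a \<in> Delta R"
  shows "u \<otimes> a \<in> Delta R"
proof -
  have ac: "a \<in> carrier R" and uc: "u \<in> carrier R"
    using a u by (auto simp: Delta_def)
  have "u \<otimes> a \<oplus> v \<in> Units R" if v: "v \<in> Units R" for v
  proof -
    have "a \<oplus> inv u \<otimes> v \<in> Units R"
      using a u v by (simp add: Delta_def)
    then have "u \<otimes> (a \<oplus> inv u \<otimes> v) \<in> Units R"
      using u by blast
    moreover have "u \<otimes> (a \<oplus> inv u \<otimes> v) = u \<otimes> a \<oplus> (u \<otimes> inv u) \<otimes> v"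
      using u v ac uc by (subst r_distr) (simp_all add: m_assoc Units_closed del: Units_r_inv)
    ultimately show ?thesis
      using u v by (simp add: Units_closed)
  qed
  then show ?thesis
    using ac uc by (simp add: Delta_def)
qed

lemma Delta_uminus_closed:
  assumes "a \<in> Delta R"
  shows "\<ominus> a \<in> Delta R"
proof -
  have "\<ominus> \<one> \<otimes> a \<in> Delta R"
    using assms uminus_Units by (intro Delta_Units_mult_closed) auto
  then show ?thesis
    using assms by (simp add: Delta_def l_minus)
qed

lemma one_notin_Delta:
  assumes "\<one> \<noteq> \<zero>"
  shows "\<one> \<notin> Delta R"
proof
  assume "\<one> \<in> Delta R"
  then have "\<one> \<oplus> \<ominus> \<one> \<in> Units R"
    using uminus_Units unfolding Delta_def by blast
  then show False
    using assms by (auto simp: r_neg Units_def)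
qed

text \<open>The element \<open>e - 1\<close> is a unit and annihilates \<open>e\<close>.\<close>

lemma Delta_idempotent_eq_zero:
  assumes "e \<in> Delta R" "e \<otimes> e = e"
  shows "e = \<zero>"
proof -
  have ec: "e \<in> carrier R"
    using assms(1) by (simp add: Delta_def)
  have "e \<oplus> \<ominus> \<one> \<in> Units R"
    using assms(1) uminus_Units unfolding Delta_def by blast
  moreover have "(e \<oplus> \<ominus> \<one>) \<otimes> e = (e \<oplus> \<ominus> \<one>) \<otimes> \<zero>"
    using ec assms(2) by (simp add: l_distr l_minus r_neg)
  ultimately show ?thesis
    using ec Units_l_cancel[of "e \<oplus> \<ominus> \<one>" e \<zero>] by simp
qed

section \<open>The condition \<open>WDeltaU\<close>: its consequences and how to recover it\<close>

lemma WDeltaU_iff: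
  "WDeltaU R \<longleftrightarrow>
     (\<forall>u. u \<in> Units R \<longleftrightarrow> u \<in> carrier R \<and> (u \<ominus> \<one> \<in> Delta R \<or> u \<oplus> \<one> \<in> Delta R))"
proof -
  have coset: "u \<in> a <+ Delta R \<longleftrightarrow> u \<in> carrier R \<and> u \<ominus> a \<in> Delta R"
    if a: "a \<in> carrier R" for u a
  proof (intro iffI conjI)
    assume "u \<in> a <+ Delta R"
    then obtain d where d: "d \<in> Delta R" "u = a \<oplus> d"
      unfolding a_l_coset_def' by blast
    then have dc: "d \<in> carrier R"
      by (simp add: Delta_def)
    then show "u \<in> carrier R"
      using d a by simp
    have "u \<ominus> a = d"
      using a d(2) dc by (simp add: minus_eq a_comm r_neg1)
    then show "u \<ominus> a \<in> Delta R"
      using d by simp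
  next
    assume u: "u \<in> carrier R \<and> u \<ominus> a \<in> Delta R"
    then have "u = a \<oplus> (u \<ominus> a)"
      using a by algebra
    then show "u \<in> a <+ Delta R"
      using u unfolding a_l_coset_def' by blast
  qed
  show ?thesis
    unfolding WDeltaU_def set_eq_iff by (auto simp: coset minus_eq)
qed

lemma WDeltaU_idempotent_trivial:
  assumes "WDeltaU R" "\<one> \<oplus> \<one> \<in> Units R" "e \<in> carrier R" "e \<otimes> e = e"
  shows "e = \<zero> \<or> e = \<one>"
proof -
  let ?v = "\<one> \<ominus> (e \<oplus> e)" and ?t = "\<one> \<oplus> \<one>"
  \<comment> \<open>\<open>Delta\<close> absorbs unit factors, so multiplying by the inverse of 2
    cancels the 2.\<close>
  have half: "a \<in> Delta R" if "?t \<otimes> a \<in> Delta R" "a \<in> carrier R" for a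
  proof -
    have "inv ?t \<otimes> (?t \<otimes> a) \<in> Delta R"
      by (rule Delta_Units_mult_closed[OF Units_inv_Units[OF assms(2)] that(1)])
    moreover have "inv ?t \<otimes> (?t \<otimes> a) = (inv ?t \<otimes> ?t) \<otimes> a"
      using that(2) assms(2) by (intro m_assoc[symmetric]) auto
    moreover have "(inv ?t \<otimes> ?t) \<otimes> a = a"
      unfolding Units_l_inv[OF assms(2)] using that(2) by simp
    ultimately show ?thesis
      by (simp only:)
  qed
  have "?v \<otimes> ?v = \<one>"
    using assms(3,4) by (simp add: ring_simprules r_distr)
  then have "?v \<in> Units R"
    using assms(3) unfolding Units_def by auto
  then consider "?v \<ominus> \<one> \<in> Delta R" | "?v \<oplus> \<one> \<in> Delta R"
    using assms(1) WDeltaU_iff by blast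
  then show ?thesis
  proof cases
    case 1
    then have "\<ominus> (?v \<ominus> \<one>) \<in> Delta R"
      by (rule Delta_uminus_closed)
    moreover have "\<ominus> (?v \<ominus> \<one>) = ?t \<otimes> e"
      using assms(3) by (simp add: ring_simprules)
    ultimately show ?thesis
      using half assms(3,4) Delta_idempotent_eq_zero by simp
  next
    case 2
    moreover have "?v \<oplus> \<one> = ?t \<otimes> (\<one> \<ominus> e)"
      using assms(3) by (simp add: ring_simprules r_distr)
    moreover have "(\<one> \<ominus> e) \<otimes> (\<one> \<ominus> e) = \<one> \<ominus> e"
      using assms(3,4) by (simp add: ring_simprules r_distr)
    ultimately have "\<one> \<ominus> e = \<zero>"
      using half assms(3) Delta_idempotent_eq_zero by simp
    then show ?thesis
      using assms(3) by simp
  qed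
qed

text \<open>As 2 is a unit, \<open>2 - 1 = 1\<close> or \<open>2 + 1 = 3\<close> lies in
  \<open>Delta\<close>, and the first is impossible in a nonzero ring.\<close>

lemma three_mem_Delta:
  assumes "WDeltaU R" "\<one> \<oplus> \<one> \<in> Units R" "\<one> \<noteq> \<zero>"
  shows "\<one> \<oplus> \<one> \<oplus> \<one> \<in> Delta R"
proof -
  have "\<one> \<oplus> \<one> \<ominus> \<one> = \<one>"
    by (simp add: minus_eq a_assoc r_neg)
  then show ?thesis
    using assms WDeltaU_iff one_notin_Delta by auto
qed

text \<open>With only the idempotents 0 and 1 available, \<open>r\<close> is \<open>u\<close> or
  \<open>u + 1\<close> or \<open>u - 1\<close> for a unit \<open>u\<close>, and \<open>u\<close> is
  1 or -1 modulo \<open>Delta\<close>. The values 2 and -2 that may arise are -1 and 1, because 3 is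
  in \<open>Delta\<close>.\<close>

lemma Delta_trichotomy:
  assumes "weakly_clean R" "WDeltaU R" "\<one> \<oplus> \<one> \<in> Units R" "\<one> \<noteq> \<zero>" "r \<in> carrier R"
  shows "r \<in> Delta R \<or> r \<ominus> \<one> \<in> Delta R \<or> r \<oplus> \<one> \<in> Delta R"
proof -
  let ?three = "\<one> \<oplus> \<one> \<oplus> \<one>"
  have three: "?three \<in> Delta R"
    using assms three_mem_Delta by blast
  obtain u e where u: "u \<in> Units R" and e: "e \<in> carrier R" "e \<otimes> e = e"
    and r: "r = u \<oplus> e \<or> r = u \<ominus> e"
    using assms(1,5) unfolding weakly_clean_def by blast
  have uc: "u \<in> carrier R" and u1: "u \<ominus> \<one> \<in> Delta R \<or> u \<oplus> \<one> \<in> Delta R"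
    using u assms(2) WDeltaU_iff by auto
  have "e = \<zero> \<or> e = \<one>"
    using WDeltaU_idempotent_trivial assms e by blast
  then consider "r = u" | "r = u \<oplus> \<one>" | "r = u \<ominus> \<one>"
    using r uc by (auto simp: minus_eq)
  then show ?thesis
  proof cases
    case 1
    then show ?thesis
      using u1 by blast
  next
    case 2
    have "r \<oplus> \<one> = (u \<ominus> \<one>) \<oplus> ?three"
      unfolding 2 using uc by (simp add: minus_eq a_assoc r_neg1 r_neg2)
    then show ?thesis
      using u1 2 three Delta_add_closed by metis
  next
    case 3
    have "r \<ominus> \<one> = (u \<oplus> \<one>) \<oplus> \<ominus> ?three"
      unfolding 3 using uc by (simp add: minus_eq a_assoc minus_add r_neg1 r_neg2)
    then show ?thesis
      using u1 3 three Delta_add_closed Delta_uminus_closed by metis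
  qed
qed

lemma Delta_eq_jacobson_radical:
  assumes "WDeltaU R"
    and tri: "\<And>r. r \<in> carrier R \<Longrightarrow> r \<in> Delta R \<or> r \<ominus> \<one> \<in> Delta R \<or> r \<oplus> \<one> \<in> Delta R"
  shows "Delta R = jacobson_radical R"
proof
  have plus_one: "\<one> \<oplus> a \<in> Units R" if "a \<in> Delta R" for a
    using that by (simp add: Delta_def a_comm)
  have "left_ideal (Delta R) R"
  proof (rule left_idealI)
    show "Delta R \<subseteq> carrier R" "\<zero> \<in> Delta R"
      by (auto simp: Delta_def Units_closed)
    fix r a assume r: "r \<in> carrier R" and a: "a \<in> Delta R"
    \<comment> \<open>Unit multipliers are already covered; for \<open>r\<close> in
      \<open>Delta\<close>, the unit \<open>1 + r\<close> takes over through
      \<open>ra = (1 + r)a - a\<close>.\<close>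
    consider "r \<in> Delta R" | "r \<in> Units R"
      using tri[OF r] r assms(1) WDeltaU_iff by blast
    then show "r \<otimes> a \<in> Delta R"
    proof cases
      case 1
      have "(\<one> \<oplus> r) \<otimes> a \<oplus> \<ominus> a \<in> Delta R"
        using 1 a plus_one
        by (intro Delta_add_closed Delta_Units_mult_closed Delta_uminus_closed) auto
      moreover have "a \<in> carrier R"
        using a by (simp add: Delta_def)
      then have "(\<one> \<oplus> r) \<otimes> a \<oplus> \<ominus> a = r \<otimes> a"
        using r by (simp add: l_distr a_comm r_neg1)
      ultimately show ?thesis
        by simp
    next
      case 2
      then show ?thesis
        using a by (rule Delta_Units_mult_closed)
    qed
  qed (rule Delta_add_closed)
  then show "Delta R \<subseteq> jacobson_radical R"
    using plus_one by (rule left_ideal_subset_jacobson_radical)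
qed (rule jacobson_radical_subset_Delta)

text \<open>No unit lies in the proper left ideal \<open>?J\<close>, while everything congruent to 1
  or -1 modulo \<open>?J\<close> is a unit. The description of the units is exported because it also
  shows that 2 is a unit.\<close>

lemma trichotomy_imp_weakly_clean_WDeltaU:
  assumes "\<one> \<noteq> \<zero>"
    and tri: "\<And>r. r \<in> carrier R \<Longrightarrow>
      r \<in> jacobson_radical R \<or> r \<ominus> \<one> \<in> jacobson_radical R \<or> r \<oplus> \<one> \<in> jacobson_radical R"
  shows "WDeltaU R" "weakly_clean R"
    "u \<in> Units R \<longleftrightarrow>
       u \<in> carrier R \<and> (u \<ominus> \<one> \<in> jacobson_radical R \<or> u \<oplus> \<one> \<in> jacobson_radical R)"
proof -
  let ?J = "jacobson_radical R"
  note J = left_idealD[OF left_ideal_jacobson_radical]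
  have not_unit: "u \<notin> Units R" if "u \<in> ?J" for u
    using that J(4)[of "inv u" u] one_notin_jacobson_radical[OF assms(1)] by auto
  have unit: "u \<in> Units R" if u: "u \<in> carrier R" "u \<ominus> \<one> \<in> ?J \<or> u \<oplus> \<one> \<in> ?J" for u
    using u(2)
  proof
    assume "u \<ominus> \<one> \<in> ?J"
    then have "\<one> \<oplus> (u \<ominus> \<one>) \<in> Units R"
      by (rule one_plus_jacobson_radical_Units)
    moreover have "\<one> \<oplus> (u \<ominus> \<one>) = u"
      using u(1) by algebra
    ultimately show ?thesis
      by simp
  next
    assume "u \<oplus> \<one> \<in> ?J"
    then have "\<ominus> (\<one> \<oplus> \<ominus> (u \<oplus> \<one>)) \<in> Units R"
      using J by (intro uminus_Units one_plus_jacobson_radical_Units) blast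
    moreover have "\<ominus> (\<one> \<oplus> \<ominus> (u \<oplus> \<one>)) = u"
      using u(1) by algebra
    ultimately show ?thesis
      by simp
  qed
  show units: "u \<in> Units R \<longleftrightarrow> u \<in> carrier R \<and> (u \<ominus> \<one> \<in> ?J \<or> u \<oplus> \<one> \<in> ?J)" for u
    using unit tri not_unit by blast
  have "Delta R \<subseteq> ?J"
  proof
    \<comment> \<open>Both \<open>r + 1\<close> and \<open>r - 1\<close> are units, hence outside
      \<open>?J\<close>, and the trichotomy leaves only \<open>r\<close> in
      \<open>?J\<close>.\<close>
    fix r assume r: "r \<in> Delta R"
    then have "r \<oplus> \<one> \<in> Units R" "r \<ominus> \<one> \<in> Units R"
      using uminus_Units by (auto simp: Delta_def minus_eq)
    then show "r \<in> ?J"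
      using tri not_unit r by (auto simp: Delta_def)
  qed
  then have "Delta R = ?J"
    using jacobson_radical_subset_Delta by blast
  then show "WDeltaU R"
    by (simp add: WDeltaU_iff units)
  show "weakly_clean R"
    unfolding weakly_clean_def
  proof
    fix r assume r: "r \<in> carrier R"
    have "(r \<ominus> \<one>) \<oplus> \<one> = r"
      using r by (simp add: minus_eq a_assoc l_neg)
    \<comment> \<open>If \<open>r\<close> is not a unit, it lies in \<open>?J\<close>, so
      \<open>r - 1\<close> is congruent to -1 and is a unit. The idempotent is 0 or 1
      accordingly.\<close>
    then consider "r \<in> Units R" | "r \<ominus> \<one> \<in> Units R"
      using tri[OF r] r units by auto
    then show "\<exists>u\<in>Units R. \<exists>e\<in>carrier R. e \<otimes> e = e \<and> (r = u \<oplus> e \<or> r = u \<ominus> e)"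
    proof cases
      case 1
      then show ?thesis
        using r by (intro bexI[of _ r] bexI[of _ \<zero>]) auto
    next
      case 2
      then show ?thesis
        using \<open>(r \<ominus> \<one>) \<oplus> \<one> = r\<close> by (intro bexI[of _ "r \<ominus> \<one>"] bexI[of _ \<one>]) auto
    qed
  qed
qed

end

theorem theorem3p10:
  fixes R :: "('a, 'b) ring_scheme" (structure)
  assumes "ring R" and "\<one> \<noteq> \<zero>"
  shows "weakly_clean R \<and> WDeltaU R \<and> \<one> \<oplus> \<one> \<in> Units R \<longleftrightarrow>
         R Quot (jacobson_radical R) \<simeq> residue_ring 3"
proof -
  interpret ring R
    by fact
  let ?J = "jacobson_radical R"
  show ?thesis
    unfolding ideal.Quot_iso_residue_ring_3_iff[OF ideal_jacobson_radical]
  proof (intro iffI conjI)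
    assume L: "weakly_clean R \<and> WDeltaU R \<and> \<one> \<oplus> \<one> \<in> Units R"
    then have tri: "r \<in> Delta R \<or> r \<ominus> \<one> \<in> Delta R \<or> r \<oplus> \<one> \<in> Delta R" if "r \<in> carrier R" for r
      using Delta_trichotomy assms(2) that by blast
    with L have "Delta R = ?J"
      using Delta_eq_jacobson_radical by blast
    then show "\<one> \<notin> ?J" "\<one> \<oplus> \<one> \<oplus> \<one> \<in> ?J"
      "\<forall>r\<in>carrier R. r \<in> ?J \<or> r \<ominus> \<one> \<in> ?J \<or> r \<oplus> \<one> \<in> ?J"
      using one_notin_Delta three_mem_Delta L assms(2) tri by auto
  next
    assume "\<one> \<notin> ?J \<and> \<one> \<oplus> \<one> \<oplus> \<one> \<in> ?J \<and>
      (\<forall>r\<in>carrier R. r \<in> ?J \<or> r \<ominus> \<one> \<in> ?J \<or> r \<oplus> \<one> \<in> ?J)"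
    \<comment> \<open>That 2 is a unit follows from the description of the units, because its
      successor 3 lies in \<open>?J\<close>.\<close>
    then show "weakly_clean R" "WDeltaU R" "\<one> \<oplus> \<one> \<in> Units R"
      using trichotomy_imp_weakly_clean_WDeltaU[OF assms(2)] by auto
  qed
qed

end
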